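(* There exists an absolute constant $c_0>0$ such that with high probability, for every integer $k$ with $0\le k\le k_0:=\sqrt{\frac{c_0 n}{\log n}}$, we have $\mathcal L_k\subseteq C_{\tau_{\mathrm{end}}}$.
   Context: Let $n\ge 1$ and $\mathcal B=\{0,1\}^n$ with the coordinatewise partial order; $\mathbf 0=(0,\dots,0)$, $\mathbf 1=(1,\dots,1)$, $|x|$ denotes the number of ones of $x$, and $\mathcal L_k=\{x\in\mathcal B:|x|=k\}$ is the $k$th level, so $|\mathcal L_k|=\binom nk$. A random decreasing walk from $\mathbf 1$ is a maximal chain $\mathbf 1=x_n>x_{n-1}>\dots>x_0=\mathbf 0$ with $x_i\in\mathcal L_i$, chosen uniformly among all $n!$ such chains (equivalently, each step turns a uniformly random remaining $1$ into $0$). The DLA process on $\mathcal B$: $C_0=\{\mathbf 0\}$; for $t\ge1$, let $\rho_t$ be a random decreasing walk from $\mathbf 1$, independent of everything before; let $v$ be the last vertex of the longest initial segment of $\rho_t$ that is disjoint from $C_{t-1}$, and set $C_t=C_{t-1}\cup\{v\}$. The process terminates at the first time $\tau_{\mathrm{end}}$ with $\mathbf 1\in C_{\tau_{\mathrm{end}}}$ (for $t>\tau_{\mathrm{end}}$ put $C_t=C_{\tau_{\mathrm{end}}}$). A vertex is occupied at time $t$ if it lies in $C_t$. "With high probability" (w.h.p.) means with probability tending to $1$ as $n\to\infty$; $\log$ is the natural logarithm. *)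

theory Defs
  imports "HOL-Probability.Probability"
begin

text \<open>Vertices of the cube {0,1}^n are represented as subsets of {0..<n}
 (the set of coordinates equal to 1); the order is inclusion, |x| = card x.
 A decreasing walk from 1 is encoded by a permutation p of [0..<n]
 (as a distinct list): step i turns coordinate p!i from 1 to 0.
 Its i-th vertex (i = 0..n) is the vertex at level n - i.\<close>

definition walk_vertex :: "nat \<Rightarrow> nat list \<Rightarrow> nat \<Rightarrow> nat set" where
  "walk_vertex n p i = {0..<n} - set (take i p)"

definition level :: "nat \<Rightarrow> nat \<Rightarrow> nat set set" where
  "level n k = {x. x \<subseteq> {0..<n} \<and> card x = k}"

text \<open>One DLA step: if 1 is already occupied the process has terminated
 (cluster frozen); otherwise add the last vertex of the longest initial
 segment of the walk avoiding the cluster, i.e. the walk vertex just before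
 the first vertex that lies in the cluster.\<close>

definition dla_step :: "nat \<Rightarrow> nat set set \<Rightarrow> nat list \<Rightarrow> nat set set" where
  "dla_step n C p =
     (if {0..<n} \<in> C then C
      else insert (walk_vertex n p (LEAST i. walk_vertex n p (Suc i) \<in> C)) C)"

definition dla_cluster :: "nat \<Rightarrow> nat list list \<Rightarrow> nat set set" where
  "dla_cluster n ws = foldl (dla_step n) {{}} ws"

text \<open>Sequences of 2^n independent uniform random decreasing walks. Each
 non-terminal step adds a new vertex, so tau_end \<le> 2^n - 1 and the cluster
 after 2^n steps is C_{tau_end}.\<close>

definition walk_seqs :: "nat \<Rightarrow> nat list list set" where
  "walk_seqs n = {ws. length ws = 2 ^ n \<and> (\<forall>p \<in> set ws. distinct p \<and> set p = {0..<n})}"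

definition dla_prob :: "nat \<Rightarrow> (nat list list \<Rightarrow> bool) \<Rightarrow> real" where
  "dla_prob n P = measure_pmf.prob (pmf_of_set (walk_seqs n)) {ws. P ws}"

end

theory Submission
  imports Defs "HOL-Combinatorics.Multiset_Permutations" "HOL-Real_Asymp.Real_Asymp"
begin

text \<open>
  Put K = k0 and M = 8 (K + 1) log n, and let T(k) = M (n choose k). By induction on k, level k is
  full at time T(k). Let v be a vertex of level k. Between T(k - 1) and T(k) all vertices below v are
  occupied, so v becomes occupied as soon as a walk passes through it without meeting the cluster
  above v. About M walks pass through v, so if at least half of them (in conditional probability)
  are not blocked, then v fails with probability at most exp(-M/4), which is below n^(-2K) and
  survives the union bound over v.

  Blocking is rare: at level k + i the fraction of occupied vertices above v is about
  T(k) / (n choose (k + i)), which is geometrically small in i and of order M (k + 1) / n at i = 1.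
  This is a small constant exactly because k0^2 log n is a small multiple of n. An exponential
  moment makes it hold outside probability exp(-(n - k)/4), again good enough for the union bound.

  The estimate is only useful far below the top of the cube, so one also needs that at time T(K) the
  cluster has not reached level n/3: the expected number of occupied vertices at level j + 1 is at
  most T / (n choose j) times that at level j, and the product of these ratios is tiny.
\<close>

section \<open>Averages over sequences\<close>

definition seqs :: "'a set \<Rightarrow> nat \<Rightarrow> 'a list set" where
  "seqs S L = {ws. set ws \<subseteq> S \<and> length ws = L}"

text \<open>Expectation under the uniform law on \<open>S\<close>; \<open>seq_avg\<close> is the
  counterpart for \<open>L\<close> independent draws, \<open>card S ^ L\<close> being the size of
  \<open>seqs S L\<close>. As finite sums, they reduce conditioning on the past to
  regrouping.\<close>

definition avg :: "'a set \<Rightarrow> ('a \<Rightarrow> real) \<Rightarrow> real" where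
  "avg S f = (\<Sum>p\<in>S. f p) / real (card S)"

definition seq_avg :: "'a set \<Rightarrow> nat \<Rightarrow> ('a list \<Rightarrow> real) \<Rightarrow> real" where
  "seq_avg S L f = (\<Sum>ws\<in>seqs S L. f ws) / real (card S) ^ L"

lemma finite_seqs: "finite S \<Longrightarrow> finite (seqs S L)"
  unfolding seqs_def by (rule finite_lists_length_eq)

lemma card_seqs: "finite S \<Longrightarrow> card (seqs S L) = card S ^ L"
  unfolding seqs_def by (rule card_lists_length_eq)

lemma sum_seqs_Suc:
  fixes f :: "'a list \<Rightarrow> real"
  assumes "finite S"
  shows "(\<Sum>ws\<in>seqs S (Suc L). f ws) = (\<Sum>ws\<in>seqs S L. \<Sum>p\<in>S. f (ws @ [p]))"
proof -
  have bij: "bij_betw (\<lambda>(ws, p). ws @ [p]) (seqs S L \<times> S) (seqs S (Suc L))"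
    by (rule bij_betw_byWitness[where f' = "\<lambda>ws. (butlast ws, last ws)"])
       (auto simp: seqs_def dest: in_set_butlastD intro!: append_butlast_last_id,
        metis Suc_length_conv last_in_set list.distinct(1) subset_iff)
  show ?thesis
    by (simp add: sum.cartesian_product sum.reindex_bij_betw[OF bij, symmetric] case_prod_unfold)
qed

lemma avg_mono: "(\<And>p. p \<in> S \<Longrightarrow> f p \<le> g p) \<Longrightarrow> avg S f \<le> avg S g"
  unfolding avg_def by (intro divide_right_mono sum_mono) auto

lemma avg_add: "avg S (\<lambda>p. f p + g p) = avg S f + avg S g"
  by (simp add: avg_def sum.distrib add_divide_distrib)

lemma avg_diff: "avg S (\<lambda>p. f p - g p) = avg S f - avg S g"
  by (simp add: avg_def sum_subtractf diff_divide_distrib)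

lemma avg_cmult: "avg S (\<lambda>p. c * f p) = c * avg S f"
  by (simp add: avg_def sum_distrib_left[symmetric])

lemma avg_const: "finite S \<Longrightarrow> S \<noteq> {} \<Longrightarrow> avg S (\<lambda>_. c) = c"
  by (simp add: avg_def)

lemma avg_sum: "avg S (\<lambda>p. \<Sum>i\<in>I. f i p) = (\<Sum>i\<in>I. avg S (f i))"
  unfolding avg_def sum_divide_distrib[symmetric] by (subst sum.swap) simp

lemma seq_avg_0 [simp]: "seq_avg S 0 f = f []"
proof -
  have "seqs S 0 = {[]}" by (auto simp: seqs_def)
  thus ?thesis by (simp add: seq_avg_def)
qed

text \<open>Tower rule: condition on the first \<open>L\<close> draws and average over the last one.
  Independence of the walks enters through this identity.\<close>

lemma seq_avg_Suc:
  "finite S \<Longrightarrow> seq_avg S (Suc L) f = seq_avg S L (\<lambda>ws. avg S (\<lambda>p. f (ws @ [p])))"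
  by (simp add: seq_avg_def avg_def sum_seqs_Suc sum_divide_distrib[symmetric])

lemma seq_avg_mono:
  "(\<And>ws. ws \<in> seqs S L \<Longrightarrow> f ws \<le> g ws) \<Longrightarrow> seq_avg S L f \<le> seq_avg S L g"
  unfolding seq_avg_def by (intro divide_right_mono sum_mono) auto

lemma seq_avg_add: "seq_avg S L (\<lambda>p. f p + g p) = seq_avg S L f + seq_avg S L g"
  by (simp add: seq_avg_def sum.distrib add_divide_distrib)

lemma seq_avg_diff: "seq_avg S L (\<lambda>p. f p - g p) = seq_avg S L f - seq_avg S L g"
  by (simp add: seq_avg_def sum_subtractf diff_divide_distrib)

lemma seq_avg_cmult: "seq_avg S L (\<lambda>p. c * f p) = c * seq_avg S L f"
  by (simp add: seq_avg_def sum_distrib_left[symmetric])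

lemma seq_avg_const: "finite S \<Longrightarrow> S \<noteq> {} \<Longrightarrow> seq_avg S L (\<lambda>_. c) = c"
  by (simp add: seq_avg_def card_seqs)

lemma seq_avg_sum: "seq_avg S L (\<lambda>p. \<Sum>i\<in>I. f i p) = (\<Sum>i\<in>I. seq_avg S L (f i))"
  unfolding seq_avg_def sum_divide_distrib[symmetric] by (subst sum.swap) simp

lemma seq_avg_cong:
  "(\<And>ws. ws \<in> seqs S L \<Longrightarrow> f ws = g ws) \<Longrightarrow> seq_avg S L f = seq_avg S L g"
  by (simp add: seq_avg_def)

text \<open>A quantity decided by the first \<open>a\<close> draws can be evaluated on sequences of
  length \<open>a\<close>, since each later draw only averages a constant.\<close>

lemma seq_avg_take:
  assumes S: "finite S" "S \<noteq> {}"
  shows "seq_avg S (a + b) (\<lambda>ws. f (take a ws)) = seq_avg S a f"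
proof (induction b)
  case 0
  show ?case by (auto intro!: seq_avg_cong simp: seqs_def)
next
  case (Suc b)
  have "seq_avg S (a + Suc b) (\<lambda>ws. f (take a ws)) = seq_avg S (a + b) (\<lambda>ws. f (take a ws))"
    unfolding add_Suc_right seq_avg_Suc[OF S(1)]
    by (rule seq_avg_cong) (simp add: seqs_def avg_const[OF S])
  with Suc show ?case by simp
qed

text \<open>Iterates a one-step conditional bound by the tower rule. It serves with
  \<open>q >= 1\<close> for the growth of an exponential moment and with \<open>q < 1\<close> for
  the decay of a survival probability; \<open>a\<close> is the time from which the bound is
  available.\<close>

lemma seq_avg_contract:
  assumes S: "finite S" and q: "q \<ge> 0"
    and step: "\<And>ws. set ws \<subseteq> S \<Longrightarrow> length ws \<ge> a \<Longrightarrow> avg S (\<lambda>p. \<Phi> (ws @ [p])) \<le> q * \<Phi> ws"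
  shows "seq_avg S (a + b) \<Phi> \<le> q ^ b * seq_avg S a \<Phi>"
proof (induction b)
  case (Suc b)
  have "seq_avg S (a + Suc b) \<Phi> \<le> seq_avg S (a + b) (\<lambda>ws. q * \<Phi> ws)"
    unfolding add_Suc_right seq_avg_Suc[OF S]
    by (rule seq_avg_mono) (auto simp: seqs_def intro!: step)
  also have "\<dots> = q * seq_avg S (a + b) \<Phi>"
    by (rule seq_avg_cmult)
  also have "\<dots> \<le> q * (q ^ b * seq_avg S a \<Phi>)"
    by (intro mult_left_mono Suc q)
  finally show ?case by simp
qed simp

section \<open>Random maximal chains\<close>

abbreviation perms :: "nat \<Rightarrow> nat list set" where
  "perms n \<equiv> permutations_of_set {0..<n}"

section \<open>Counting permutations by their prefix sets\<close>

text \<open>Cut the permutation after its first \<open>card A\<close> entries. The predicate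
  \<open>P\<close> on the prefix permits a second cut inside \<open>A\<close>, which yields the
  count for two nested prefix sets.\<close>

lemma permutations_of_set_prefix_bij:
  assumes "A \<subseteq> D" "finite D"
  shows "bij_betw (\<lambda>(q, r). q @ r)
    ({q \<in> permutations_of_set A. P q} \<times> permutations_of_set (D - A))
    {p \<in> permutations_of_set D. set (take (card A) p) = A \<and> P (take (card A) p)}"
proof (rule bij_betw_byWitness[where f' = "\<lambda>p. (take (card A) p, drop (card A) p)"])
  let ?L = "{q \<in> permutations_of_set A. P q} \<times> permutations_of_set (D - A)"
  let ?R = "{p \<in> permutations_of_set D. set (take (card A) p) = A \<and> P (take (card A) p)}"
  have len: "length q = card A" if "q \<in> permutations_of_set A" for q
    using that by (auto simp: permutations_of_set_def distinct_card)
  show "\<forall>a\<in>?L. (\<lambda>p. (take (card A) p, drop (card A) p)) ((\<lambda>(q, r). q @ r) a) = a"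
    using len by auto
  show "\<forall>a\<in>?R. (\<lambda>(q, r). q @ r) (take (card A) a, drop (card A) a) = a"
    by auto
  show "(\<lambda>(q, r). q @ r) ` ?L \<subseteq> ?R"
    using len assms by (auto simp: permutations_of_set_def)
  show "(\<lambda>p. (take (card A) p, drop (card A) p)) ` ?R \<subseteq> ?L"
  proof (clarsimp, intro conjI)
    fix p assume p: "p \<in> permutations_of_set D" "set (take (card A) p) = A"
    have d: "distinct (take (card A) p @ drop (card A) p)" and
      s: "set (take (card A) p) \<union> set (drop (card A) p) = D"
      unfolding set_append[symmetric] append_take_drop_id
      using p(1) by (simp_all add: permutations_of_set_def)
    show "take (card A) p \<in> permutations_of_set A"
      using p d unfolding distinct_append permutations_of_set_def by blast
    show "drop (card A) p \<in> permutations_of_set (D - A)"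
      using p d s unfolding distinct_append permutations_of_set_def by blast
  qed
qed

lemma card_permutations_of_set_prefix:
  assumes "A \<subseteq> D" "finite D"
  shows "card {p \<in> permutations_of_set D. set (take (card A) p) = A \<and> P (take (card A) p)}
    = card {q \<in> permutations_of_set A. P q} * fact (card (D - A))"
  using bij_betw_same_card[OF permutations_of_set_prefix_bij[OF assms, of P]] assms
  by (simp add: card_cartesian_product)

lemma card_permutations_of_set_prefix1:
  assumes "A \<subseteq> D" "finite D"
  shows "card {p \<in> permutations_of_set D. set (take (card A) p) = A}
    = fact (card A) * fact (card (D - A))"
  using card_permutations_of_set_prefix[OF assms, of "\<lambda>_. True"] finite_subset[OF assms]
  by simp

lemma card_permutations_of_set_prefix2:
  assumes "A \<subseteq> B" "B \<subseteq> D" "finite D"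
  shows "card {p \<in> permutations_of_set D. set (take (card B) p) = B \<and> set (take (card A) p) = A}
    = fact (card A) * fact (card (B - A)) * fact (card (D - B))"
proof -
  have fin: "finite B" using assms finite_subset by auto
  have le: "card A \<le> card B" using assms(1) fin by (rule card_mono[rotated])
  show ?thesis
    using card_permutations_of_set_prefix[OF assms(2,3), of "\<lambda>q. set (take (card A) q) = A"] le
      card_permutations_of_set_prefix1[OF assms(1) fin]
    by (simp add: min_absorb1)
qed

lemma perms_nonempty: "finite (perms n)" "perms n \<noteq> {}"
  by auto

lemma avg_perms_card: "avg (perms n) (\<lambda>p. of_bool (P p)) = card {p \<in> perms n. P p} / fact n"
  by (simp add: avg_def perms_nonempty sum.If_cases of_bool_def Int_def)

section \<open>Hitting probabilities of a random decreasing walk\<close>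

lemma walk_vertex_eq_iff:
  assumes "x \<subseteq> {0..<n}" "p \<in> perms n"
  shows "walk_vertex n p i = x \<longleftrightarrow> set (take i p) = {0..<n} - x"
proof -
  have "set (take i p) \<subseteq> {0..<n}"
    using assms(2) set_take_subset[of i p] by (auto simp: permutations_of_set_def)
  with assms(1) show ?thesis unfolding walk_vertex_def by blast
qed

lemma card_walk_vertex:
  assumes "p \<in> perms n" "i \<le> n"
  shows "card (walk_vertex n p i) = n - i"
proof -
  have p: "set p = {0..<n}" "distinct p" "length p = n"
    using assms distinct_card by (fastforce simp: permutations_of_set_def)+
  have "set (take i p) \<subseteq> {0..<n}" using set_take_subset[of i p] p by simp
  moreover have "card (set (take i p)) = i"
    using p assms by (simp add: distinct_card)
  ultimately show ?thesis unfolding walk_vertex_def by (simp add: card_Diff_subset)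
qed

text \<open>A walk visits \<open>x\<close> exactly when its first \<open>n - j\<close> entries form
  the complement of \<open>x\<close>; this holds for (n - j)! j! of the n! permutations.\<close>

lemma prob_walk_through:
  assumes x: "x \<in> level n j"
  shows "avg (perms n) (\<lambda>p. of_bool (walk_vertex n p (n - j) = x)) = 1 / real (n choose j)"
proof -
  have x': "x \<subseteq> {0..<n}" "card x = j" "finite x"
    using x by (auto simp: level_def intro: finite_subset)
  have jn: "j \<le> n" using card_mono[of "{0..<n}" x] x' by simp
  have c: "card ({0..<n} - x) = n - j" using x' by (simp add: card_Diff_subset)
  have "{p \<in> perms n. walk_vertex n p (n - j) = x} =
     {p \<in> perms n. set (take (card ({0..<n} - x)) p) = {0..<n} - x}"
    unfolding c by (intro Collect_cong conj_cong refl walk_vertex_eq_iff x')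
  hence "card {p \<in> perms n. walk_vertex n p (n - j) = x} = fact (n - j) * fact j"
    using card_permutations_of_set_prefix1[of "{0..<n} - x" "{0..<n}"] x' c
    by (simp add: double_diff)
  thus ?thesis unfolding avg_perms_card by (simp add: binomial_fact[OF jn])
qed

text \<open>The complements of \<open>x\<close> and \<open>v\<close> are nested prefix sets, giving
  (n - j)! (j - k)! k! permutations. The product form displays the chance of reaching
  \<open>v\<close> times the conditional chance of \<open>x\<close>, which is the weight in
  \<open>blocking\<close>.\<close>

lemma prob_walk_through2:
  assumes v: "v \<in> level n k" and x: "x \<in> level n j" and vx: "v \<subseteq> x"
  shows "avg (perms n) (\<lambda>p. of_bool (walk_vertex n p (n - k) = v \<and> walk_vertex n p (n - j) = x))
    = 1 / (real (n choose k) * real ((n - k) choose (j - k)))"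
proof -
  have x': "x \<subseteq> {0..<n}" "card x = j" "finite x"
    using x by (auto simp: level_def intro: finite_subset)
  have v': "v \<subseteq> {0..<n}" "card v = k" "finite v"
    using v by (auto simp: level_def intro: finite_subset)
  have jn: "j \<le> n" using card_mono[of "{0..<n}" x] x' by simp
  have kj: "k \<le> j" using card_mono[of x v] x' v' vx by simp
  have c: "card ({0..<n} - x) = n - j" "card ({0..<n} - v) = n - k"
    using x' v' by (simp_all add: card_Diff_subset)
  have d: "{0..<n} - v - ({0..<n} - x) = x - v" using x' by auto
  have cd: "card (x - v) = j - k" using x' v' vx by (simp add: card_Diff_subset)
  have "{p \<in> perms n. walk_vertex n p (n - k) = v \<and> walk_vertex n p (n - j) = x} =
     {p \<in> perms n. set (take (card ({0..<n} - v)) p) = {0..<n} - v \<and>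
        set (take (card ({0..<n} - x)) p) = {0..<n} - x}"
    unfolding c by (intro Collect_cong conj_cong refl walk_vertex_eq_iff x' v')
  hence "card {p \<in> perms n. walk_vertex n p (n - k) = v \<and> walk_vertex n p (n - j) = x}
     = fact (n - j) * fact (j - k) * fact k"
    using card_permutations_of_set_prefix2[OF Diff_mono[OF order_refl vx] Diff_subset, of "{0..<n}"]
      v' unfolding c d cd by (simp add: double_diff)
  thus ?thesis unfolding avg_perms_card using kj jn
    by (simp add: binomial_fact field_simps)
qed

lemma card_level: "card (level n k) = n choose k"
  unfolding level_def using n_subsets[of "{0..<n}" k] by simp

lemma finite_level: "finite (level n k)"
  unfolding level_def by (rule finite_subset[of _ "Pow {0..<n}"]) auto

lemma card_level_above:
  assumes v: "v \<in> level n k" and "k \<le> j"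
  shows "card {x \<in> level n j. v \<subseteq> x} = (n - k) choose (j - k)"
proof -
  have v': "v \<subseteq> {0..<n}" "card v = k" "finite v"
    using v by (auto simp: level_def intro: finite_subset)
  let ?Y = "{y. y \<subseteq> {0..<n} - v \<and> card y = j - k}"
  have "bij_betw (\<lambda>x. x - v) {x \<in> level n j. v \<subseteq> x} ?Y"
  proof (rule bij_betw_byWitness[where f' = "\<lambda>y. y \<union> v"])
    show "(\<lambda>x. x - v) ` {x \<in> level n j. v \<subseteq> x} \<subseteq> ?Y"
      using v' by (auto simp: level_def card_Diff_subset)
    show "(\<lambda>y. y \<union> v) ` ?Y \<subseteq> {x \<in> level n j. v \<subseteq> x}"
    proof (clarsimp simp: level_def, intro conjI)
      fix y assume y: "y \<subseteq> {0..<n} - v" "card y = j - k"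
      have "finite y" using y finite_subset by blast
      moreover have "y \<inter> v = {}" using y by auto
      ultimately show "card (y \<union> v) = j"
        using y v' assms(2) by (simp add: card_Un_disjoint)
    qed (use v' in auto)
  qed (auto simp: level_def)
  hence "card {x \<in> level n j. v \<subseteq> x} = card ?Y" by (rule bij_betw_same_card)
  also have "\<dots> = card ({0..<n} - v) choose (j - k)" by (rule n_subsets) simp
  also have "card ({0..<n} - v) = n - k" using v' by (simp add: card_Diff_subset)
  finally show ?thesis .
qed

text \<open>Sums the uniform law of the level-j vertex over the vertices above \<open>v\<close>. The
  numerator later cancels against the weight in \<open>blocking\<close>.\<close>

lemma prob_walk_above:
  assumes v: "v \<in> level n k" and "k \<le> j" "j \<le> n"
  shows "avg (perms n) (\<lambda>p. of_bool (v \<subseteq> walk_vertex n p (n - j)))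
    = real ((n - k) choose (j - k)) / real (n choose j)"
proof -
  have "avg (perms n) (\<lambda>p. of_bool (v \<subseteq> walk_vertex n p (n - j)))
     = avg (perms n) (\<lambda>p. \<Sum>x | x \<in> level n j \<and> v \<subseteq> x. of_bool (walk_vertex n p (n - j) = x))"
    unfolding avg_def
  proof (intro arg_cong2[where f = divide] sum.cong refl)
    fix p assume p: "p \<in> perms n"
    have l: "walk_vertex n p (n - j) \<in> level n j"
      using card_walk_vertex[OF p, of "n - j"] assms by (auto simp: level_def walk_vertex_def)
    show "of_bool (v \<subseteq> walk_vertex n p (n - j)) =
       (\<Sum>x | x \<in> level n j \<and> v \<subseteq> x. of_bool (walk_vertex n p (n - j) = x) :: real)"
      using l finite_level[of n j] by (simp add: of_bool_def)
  qed
  also have "\<dots> = (\<Sum>x | x \<in> level n j \<and> v \<subseteq> x. 1 / real (n choose j))"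
    unfolding avg_sum by (intro sum.cong refl prob_walk_through) auto
  also have "\<dots> = real ((n - k) choose (j - k)) / real (n choose j)"
    using card_level_above[OF assms(1,2)] by simp
  finally show ?thesis .
qed

section \<open>The cluster\<close>

lemma dla_cluster_snoc: "dla_cluster n (ws @ [p]) = dla_step n (dla_cluster n ws) p"
  by (simp add: dla_cluster_def)

lemma dla_step_mono: "C \<subseteq> dla_step n C p"
  by (auto simp: dla_step_def)

lemma dla_cluster_append_mono: "dla_cluster n ws \<subseteq> dla_cluster n (ws @ us)"
proof (induction us rule: rev_induct)
  case (snoc u us)
  thus ?case
    using dla_step_mono[of "dla_cluster n (ws @ us)" n u] dla_cluster_snoc[of n "ws @ us" u] by auto
qed simp

lemma walk_vertex_last: "p \<in> perms n \<Longrightarrow> walk_vertex n p n = {}"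
  using distinct_card[of p] by (auto simp: walk_vertex_def permutations_of_set_def)

lemma walk_vertex_antimono: "i \<le> j \<Longrightarrow> walk_vertex n p j \<subseteq> walk_vertex n p i"
  unfolding walk_vertex_def using set_take_subset_set_take[of i j p] by blast

lemma dla_step_new:
  assumes p: "p \<in> perms n" and C: "{} \<in> C" and x: "x \<in> dla_step n C p" "x \<notin> C"
  shows "dla_step n C p = insert x C"
    and "\<exists>i<n. x = walk_vertex n p i \<and> walk_vertex n p (Suc i) \<in> C"
proof -
  have nC: "{0..<n} \<notin> C" using x by (auto simp: dla_step_def split: if_splits)
  hence n0: "n \<noteq> 0" using C by (metis atLeastLessThan_empty order_refl)
  define i where "i = (LEAST i. walk_vertex n p (Suc i) \<in> C)"
  \<comment> \<open>The walk ends in \<open>{}\<close>, which is occupied, so \<open>LEAST\<close>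
    ranges over a nonempty set and its value is below \<open>n\<close>.\<close>
  have ex: "walk_vertex n p (Suc (n - 1)) \<in> C"
    using walk_vertex_last[OF p] C n0 by simp
  have i: "walk_vertex n p (Suc i) \<in> C" unfolding i_def by (rule LeastI, rule ex)
  have "i \<le> n - 1" unfolding i_def by (rule Least_le, rule ex)
  hence "i < n" using n0 by simp
  moreover have st: "dla_step n C p = insert (walk_vertex n p i) C"
    using nC by (simp add: dla_step_def i_def)
  moreover have "x = walk_vertex n p i" using st x by auto
  ultimately show "dla_step n C p = insert x C"
    "\<exists>i<n. x = walk_vertex n p i \<and> walk_vertex n p (Suc i) \<in> C"
    using i by auto
qed

lemma dla_step_occupies:
  assumes nC: "{0..<n} \<notin> C" and free: "\<And>j. j \<le> i \<Longrightarrow> walk_vertex n p j \<notin> C"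
    and hit: "walk_vertex n p (Suc i) \<in> C"
  shows "walk_vertex n p i \<in> dla_step n C p"
proof -
  have "(LEAST i. walk_vertex n p (Suc i) \<in> C) = i"
  proof (rule Least_equality)
    fix j assume "walk_vertex n p (Suc j) \<in> C"
    thus "i \<le> j" using free[of "Suc j"] by (meson not_less_eq_eq)
  qed (rule hit)
  thus ?thesis using nC by (simp add: dla_step_def)
qed

text \<open>A new vertex immediately precedes, on its walk, an occupied vertex one level lower; the
  third claim records that occupied levels therefore have no gaps.\<close>

lemma dla_cluster_invariants:
  assumes "set ws \<subseteq> perms n"
  shows "{} \<in> dla_cluster n ws" and "dla_cluster n ws \<subseteq> Pow {0..<n}"
    and "x \<in> dla_cluster n ws \<Longrightarrow> card x > 0 \<Longrightarrow>
      \<exists>y\<in>dla_cluster n ws. card x = Suc (card y)"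
  using assms
proof (induction ws arbitrary: x rule: rev_induct)
  case Nil
  { case 1 show ?case by (simp add: dla_cluster_def) }
  { case 2 show ?case by (simp add: dla_cluster_def) }
  { case 3 thus ?case by (simp add: dla_cluster_def) }
next
  case (snoc p ws)
  { case 1 thus ?case using snoc dla_step_mono[of "dla_cluster n ws" n p]
      by (auto simp: dla_cluster_snoc) }
  { case 2
    hence p: "p \<in> perms n" and ws: "set ws \<subseteq> perms n" by auto
    show ?case
    proof
      fix x assume x: "x \<in> dla_cluster n (ws @ [p])"
      show "x \<in> Pow {0..<n}"
      proof (cases "x \<in> dla_cluster n ws")
        case False
        from dla_step_new(2)[OF p snoc.IH(1)[OF ws], of x] x False
        show ?thesis by (auto simp: dla_cluster_snoc walk_vertex_def)
      qed (use snoc.IH(2)[OF ws] in auto)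
    qed }
  { case 3
    hence p: "p \<in> perms n" and ws: "set ws \<subseteq> perms n" by auto
    have mono: "dla_cluster n ws \<subseteq> dla_cluster n (ws @ [p])"
      by (rule dla_cluster_append_mono)
    show ?case
    proof (cases "x \<in> dla_cluster n ws")
      case True
      thus ?thesis using snoc.IH(3)[OF True _ ws] 3 mono by blast
    next
      case False
      from dla_step_new(2)[OF p snoc.IH(1)[OF ws], of x] 3(1) False
      obtain i where i: "i < n" "x = walk_vertex n p i" "walk_vertex n p (Suc i) \<in> dla_cluster n ws"
        by (auto simp: dla_cluster_snoc)
      have "card x = Suc (card (walk_vertex n p (Suc i)))"
        using card_walk_vertex[OF p, of i] card_walk_vertex[OF p, of "Suc i"] i by simp
      thus ?thesis using i mono by blast
    qed }
qed

text \<open>Descend from \<open>x\<close> through occupied vertices one level at a time. In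
  contrapositive form: a cluster that misses level \<open>h\<close> lies entirely below it.\<close>

lemma dla_cluster_level_reached:
  assumes ws: "set ws \<subseteq> perms n" and x: "x \<in> dla_cluster n ws" "card x \<ge> h"
  shows "dla_cluster n ws \<inter> level n h \<noteq> {}"
  using x
proof (induction "card x" arbitrary: x)
  case 0
  have "x \<in> level n h"
    using dla_cluster_invariants(2)[OF ws] 0 by (auto simp: level_def)
  thus ?case using 0 by auto
next
  case (Suc c)
  show ?case
  proof (cases "card x = h")
    case True
    hence "x \<in> level n h"
      using dla_cluster_invariants(2)[OF ws] Suc by (auto simp: level_def)
    thus ?thesis using Suc by auto
  next
    case False
    obtain y where "y \<in> dla_cluster n ws" "card x = Suc (card y)"
      using dla_cluster_invariants(3)[OF ws Suc.prems(1)] Suc(2) by auto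
    thus ?thesis using Suc False by auto
  qed
qed

section \<open>The height of the cluster\<close>

definition occ :: "nat \<Rightarrow> nat \<Rightarrow> nat list list \<Rightarrow> real" where
  "occ n j ws = real (card (dla_cluster n ws \<inter> level n j))"

lemma finite_cluster_level: "finite (dla_cluster n ws \<inter> level n j)"
  using finite_level by auto

lemma occ_Nil: "j > 0 \<Longrightarrow> occ n j [] = 0"
  by (auto simp: occ_def dla_cluster_def level_def)

text \<open>Level \<open>Suc j\<close> grows only if the walk meets the cluster at its level-j
  vertex, which has index \<open>n - j\<close>, and then by one vertex. The sum is the indicator of
  that vertex being occupied, in a form that can be averaged term by term.\<close>

lemma occ_step:
  assumes ws: "set ws \<subseteq> perms n" and p: "p \<in> perms n"
  shows "occ n (Suc j) (ws @ [p]) \<le> occ n (Suc j) ws +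
    (\<Sum>x\<in>dla_cluster n ws \<inter> level n j. of_bool (walk_vertex n p (n - j) = x))"
proof -
  let ?C = "dla_cluster n ws" and ?C' = "dla_cluster n (ws @ [p])"
  let ?s = "\<Sum>x\<in>?C \<inter> level n j. of_bool (walk_vertex n p (n - j) = x) :: real"
  show ?thesis
  proof (cases "?C' \<inter> level n (Suc j) \<subseteq> ?C")
    case True
    hence "?C' \<inter> level n (Suc j) \<subseteq> ?C \<inter> level n (Suc j)" by auto
    hence "occ n (Suc j) (ws @ [p]) \<le> occ n (Suc j) ws"
      unfolding occ_def using card_mono[OF finite_cluster_level] by simp
    moreover have "?s \<ge> 0" by (intro sum_nonneg) auto
    ultimately show ?thesis by linarith
  next
    case False
    then obtain x where x: "x \<in> dla_step n ?C p" "x \<in> level n (Suc j)" "x \<notin> ?C"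
      by (auto simp: dla_cluster_snoc)
    note new = dla_step_new[OF p dla_cluster_invariants(1)[OF ws] x(1,3)]
    obtain i where i: "i < n" "x = walk_vertex n p i" "walk_vertex n p (Suc i) \<in> ?C"
      using new(2) by blast
    have "Suc j = n - i" using x(2) card_walk_vertex[OF p, of i] i by (simp add: level_def)
    hence ij: "Suc i = n - j" using i by simp
    have l: "walk_vertex n p (n - j) \<in> ?C \<inter> level n j"
      using i ij card_walk_vertex[OF p, of "Suc i"]
      by (auto simp: level_def walk_vertex_def)
    have "?s \<ge> of_bool (walk_vertex n p (n - j) = walk_vertex n p (n - j))"
      by (rule member_le_sum[OF l]) (auto intro: finite_cluster_level)
    moreover have "?C' \<inter> level n (Suc j) = insert x (?C \<inter> level n (Suc j))"
      using new(1) x by (auto simp: dla_cluster_snoc)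
    hence "occ n (Suc j) (ws @ [p]) \<le> occ n (Suc j) ws + 1"
      using card_insert_le_m1 finite_cluster_level[of n ws "Suc j"] unfolding occ_def
      by (simp add: card_insert_if)
    ultimately show ?thesis by simp
  qed
qed

lemma occ_le_length: "set ws \<subseteq> perms n \<Longrightarrow> occ n (Suc j) ws \<le> length ws"
proof (induction ws rule: rev_induct)
  case (snoc p ws)
  have "(\<Sum>x\<in>dla_cluster n ws \<inter> level n j. of_bool (walk_vertex n p (n - j) = x) :: real) \<le> 1"
    using finite_cluster_level[of n ws j] by (simp add: of_bool_def)
  thus ?case using occ_step[of ws n p j] snoc by simp
qed (simp add: occ_Nil)

lemma avg_occ_step:
  assumes ws: "set ws \<subseteq> perms n"
  shows "avg (perms n) (\<lambda>p. occ n (Suc j) (ws @ [p]))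
    \<le> occ n (Suc j) ws + occ n j ws / real (n choose j)"
proof -
  have "avg (perms n) (\<lambda>p. occ n (Suc j) (ws @ [p])) \<le> avg (perms n) (\<lambda>p. occ n (Suc j) ws +
      (\<Sum>x\<in>dla_cluster n ws \<inter> level n j. of_bool (walk_vertex n p (n - j) = x)))"
    by (intro avg_mono occ_step ws)
  also have "\<dots> = occ n (Suc j) ws + (\<Sum>x\<in>dla_cluster n ws \<inter> level n j. 1 / real (n choose j))"
    unfolding avg_add avg_sum avg_const[OF perms_nonempty]
    by (intro arg_cong2[where f = "(+)"] refl sum.cong prob_walk_through) auto
  finally show ?thesis by (simp add: occ_def)
qed

text \<open>Adds up the one-step bounds; a bound \<open>a\<close> for level j valid at all times up
  to \<open>T\<close> controls every increment.\<close>

lemma seq_avg_occ_Suc: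
  assumes a: "\<And>t. t \<le> T \<Longrightarrow> seq_avg (perms n) t (occ n j) \<le> a" and a0: "a \<ge> 0" and t: "t \<le> T"
  shows "seq_avg (perms n) t (occ n (Suc j)) \<le> real T * a / real (n choose j)"
proof -
  have "seq_avg (perms n) t (occ n (Suc j)) \<le> real t * (a / real (n choose j))"
    using t
  proof (induction t)
    case 0
    show ?case by (simp add: occ_Nil)
  next
    case (Suc t)
    have "seq_avg (perms n) (Suc t) (occ n (Suc j))
        \<le> seq_avg (perms n) t (\<lambda>ws. occ n (Suc j) ws + (1 / real (n choose j)) * occ n j ws)"
      unfolding seq_avg_Suc[OF perms_nonempty(1)]
      by (rule seq_avg_mono) (use avg_occ_step in \<open>auto simp: seqs_def\<close>)
    also have "\<dots> = seq_avg (perms n) t (occ n (Suc j))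
        + (1 / real (n choose j)) * seq_avg (perms n) t (occ n j)"
      unfolding seq_avg_add seq_avg_cmult ..
    also have "\<dots> \<le> real t * (a / real (n choose j)) + (1 / real (n choose j)) * a"
      using Suc a[of t] by (intro add_mono mult_left_mono) auto
    finally show ?case by (simp add: algebra_simps add_divide_distrib)
  qed
  also have "\<dots> \<le> real T * (a / real (n choose j))"
    using t a0 by (intro mult_right_mono) auto
  finally show ?thesis by simp
qed

text \<open>The recursion starts at level \<open>Suc k\<close> from the trivial bound of one new
  vertex per walk. In the application T is M (n choose k), so the ratios T / (n choose j) start to
  decay only above level k.\<close>

lemma seq_avg_occ:
  "t \<le> T \<Longrightarrow> seq_avg (perms n) t (occ n (Suc k + m)) \<le> real T * (\<Prod>i=1..m. real T / real (n choose (k + i)))"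
proof (induction m arbitrary: t)
  case 0
  have "seq_avg (perms n) t (occ n (Suc k)) \<le> seq_avg (perms n) t (\<lambda>_. real t)"
    by (rule seq_avg_mono) (use occ_le_length in \<open>fastforce simp: seqs_def\<close>)
  also have "\<dots> = real t" by (rule seq_avg_const[OF perms_nonempty])
  finally show ?case using 0 by simp
next
  case (Suc m)
  have nn: "0 \<le> real T * (\<Prod>i=1..m. real T / real (n choose (k + i)))"
    by (intro prod_nonneg mult_nonneg_nonneg) auto
  have "seq_avg (perms n) t (occ n (Suc (Suc k + m))) \<le>
     real T * (real T * (\<Prod>i=1..m. real T / real (n choose (k + i)))) / real (n choose (Suc k + m))"
    by (rule seq_avg_occ_Suc[OF Suc.IH nn Suc.prems])
  thus ?case by (simp add: field_simps)
qed

section \<open>Blocking of a vertex by the cluster above it\<close>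

text \<open>In the application the cap \<open>h\<close> is at most n/3, where binomial coefficients
  grow geometrically; it loses nothing while the cluster has not reached level
  \<open>h\<close>.\<close>

definition cluster_above :: "nat \<Rightarrow> nat \<Rightarrow> nat set \<Rightarrow> nat list list \<Rightarrow> nat set set" where
  "cluster_above n h v ws = {x \<in> dla_cluster n ws. v \<subset> x \<and> card x \<le> h}"

text \<open>A walk conditioned on passing through v passes through a given x above v with probability
  1 / ((n - |v|) choose (|x| - |v|)), so this sum bounds the conditional probability of being
  stopped before reaching v.\<close>

definition blocking :: "nat \<Rightarrow> nat \<Rightarrow> nat set \<Rightarrow> nat list list \<Rightarrow> real" where
  "blocking n h v ws =
     (\<Sum>x\<in>cluster_above n h v ws. 1 / real ((n - card v) choose (card x - card v)))"

lemma finite_cluster_above: "set ws \<subseteq> perms n \<Longrightarrow> finite (cluster_above n h v ws)"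
  by (rule finite_subset[of _ "Pow {0..<n}"])
     (auto simp: cluster_above_def dest: dla_cluster_invariants(2))

lemma cluster_above_levels:
  assumes v: "v \<in> level n k" and ws: "set ws \<subseteq> perms n" and x: "x \<in> cluster_above n h v ws"
  shows "x \<in> level n (card x)" "k < card x" "card x \<le> h" "v \<subseteq> x"
proof -
  have s: "x \<subseteq> {0..<n}"
    using x dla_cluster_invariants(2)[OF ws] by (auto simp: cluster_above_def)
  thus "x \<in> level n (card x)" by (simp add: level_def)
  have "finite x" using s finite_subset by blast
  thus "k < card x" using x v psubset_card_mono[of x v] by (auto simp: cluster_above_def level_def)
qed (use x in \<open>auto simp: cluster_above_def\<close>)

text \<open>Induction through Pascal's rule. It makes each weight in \<open>blocking\<close> at most
  1 / (n - k).\<close>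

lemma binomial_ge_self: "0 < i \<Longrightarrow> i < n \<Longrightarrow> n \<le> n choose i"
proof (induction n arbitrary: i)
  case (Suc n)
  then obtain l where l: "i = Suc l" using gr0_implies_Suc by blast
  show ?case
  proof (cases "i < n")
    case True
    hence "n \<le> n choose i" "n choose l > 0" using Suc l by (auto simp: zero_less_binomial_iff)
    thus ?thesis unfolding l binomial_Suc_Suc by linarith
  next
    case False
    hence "i = n" using Suc by simp
    thus ?thesis using binomial_symmetric[of n "Suc n"] by simp
  qed
qed simp

text \<open>At most one vertex joins, and it lies on the walk. The two upper bounds on the increment
  have different uses: the uniform one permits linearising an exponential, the other has a
  computable average.\<close>

lemma blocking_step:
  assumes v: "v \<in> level n k" and ws: "set ws \<subseteq> perms n" and p: "p \<in> perms n" and h: "h < n"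
  obtains d where "blocking n h v (ws @ [p]) = blocking n h v ws + d"
    "0 \<le> d" "d \<le> 1 / real (n - k)"
    "d \<le> (\<Sum>j\<in>{k<..h}. of_bool (v \<subseteq> walk_vertex n p (n - j)) / real ((n - k) choose (j - k)))"
proof (cases "cluster_above n h v (ws @ [p]) = cluster_above n h v ws")
  case True
  show ?thesis
    by (rule that[of 0]) (auto simp: blocking_def True intro!: sum_nonneg)
next
  case False
  have ws': "set (ws @ [p]) \<subseteq> perms n" using ws p by simp
  have cv: "card v = k" using v by (simp add: level_def)
  obtain x where x: "x \<in> cluster_above n h v (ws @ [p])" "x \<notin> cluster_above n h v ws"
    using False dla_cluster_append_mono[of n ws "[p]"] by (auto simp: cluster_above_def)
  hence xC: "x \<in> dla_step n (dla_cluster n ws) p" "x \<notin> dla_cluster n ws"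
    by (auto simp: cluster_above_def dla_cluster_snoc)
  note new = dla_step_new[OF p dla_cluster_invariants(1)[OF ws] xC]
  note lx = cluster_above_levels[OF v ws' x(1)]
  obtain i where i: "i < n" "x = walk_vertex n p i" using new(2) by blast
  have "card x = n - i" using card_walk_vertex[OF p, of i] i by simp
  hence "n - card x = i" using i(1) by simp
  hence wx: "walk_vertex n p (n - card x) = x" using i(2) by (simp only:)
  define d where "d = 1 / real ((n - k) choose (card x - k))"
  have ab: "cluster_above n h v (ws @ [p]) = insert x (cluster_above n h v ws)"
    using new(1) x by (auto simp: cluster_above_def dla_cluster_snoc)
  show ?thesis
  proof (rule that[of d])
    show "blocking n h v (ws @ [p]) = blocking n h v ws + d"
      unfolding blocking_def ab using finite_cluster_above[OF ws] x(2) cv by (simp add: d_def)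
    have "n - k \<le> (n - k) choose (card x - k)"
      using lx h by (intro binomial_ge_self) auto
    moreover have "n - k > 0" using lx h by simp
    ultimately show "d \<le> 1 / real (n - k)" unfolding d_def
      by (simp add: frac_le)
    have "of_bool (v \<subseteq> walk_vertex n p (n - card x)) / real ((n - k) choose (card x - k)) \<le>
      (\<Sum>j\<in>{k<..h}. of_bool (v \<subseteq> walk_vertex n p (n - j)) / real ((n - k) choose (j - k)))"
      by (rule member_le_sum[where i = "card x"]) (use lx in auto)
    thus "d \<le> (\<Sum>j\<in>{k<..h}. of_bool (v \<subseteq> walk_vertex n p (n - j)) / real ((n - k) choose (j - k)))"
      using lx(4) wx by (simp add: d_def)
  qed (simp add: d_def)
qed

text \<open>The scale \<open>l\<close> makes every increment y of the exponent at most 1, where exp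
  y <= 1 + y + y^2 <= 1 + 2 y; averaging then gives multiplicative growth.\<close>

lemma avg_exp_blocking_step:
  assumes v: "v \<in> level n k" and ws: "set ws \<subseteq> perms n" and h: "h < n" "k < n"
  defines "l \<equiv> real (n - k)"
  shows "avg (perms n) (\<lambda>p. exp (l * blocking n h v (ws @ [p])))
    \<le> (1 + 2 * l * (\<Sum>j\<in>{k<..h}. 1 / real (n choose j))) * exp (l * blocking n h v ws)"
proof -
  let ?X = "\<lambda>p. \<Sum>j\<in>{k<..h}. of_bool (v \<subseteq> walk_vertex n p (n - j)) / real ((n - k) choose (j - k))"
  let ?b = "exp (l * blocking n h v ws)"
  have l0: "l > 0" using h by (simp add: l_def)
  have "avg (perms n) (\<lambda>p. exp (l * blocking n h v (ws @ [p]))) \<le> avg (perms n) (\<lambda>p. ?b * (1 + 2 * l * ?X p))"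
  proof (rule avg_mono)
    fix p assume p: "p \<in> perms n"
    obtain d where d: "blocking n h v (ws @ [p]) = blocking n h v ws + d"
      "0 \<le> d" "d \<le> 1 / real (n - k)" "d \<le> ?X p"
      by (rule blocking_step[OF v ws p h(1)])
    have ld: "0 \<le> l * d" "l * d \<le> 1" using d(2,3) l0 unfolding l_def[symmetric] by (auto simp: field_simps)
    have "exp (l * d) \<le> 1 + l * d + (l * d)\<^sup>2" using ld by (rule exp_bound)
    also have "(l * d)\<^sup>2 \<le> l * d" using ld by (simp add: power2_eq_square mult_left_le)
    also have "l * d \<le> l * ?X p" using d l0 by simp
    finally have "exp (l * d) \<le> 1 + 2 * l * ?X p" using ld d(4) l0
      by (simp add: mult_left_mono[OF d(4)])
    thus "exp (l * blocking n h v (ws @ [p])) \<le> ?b * (1 + 2 * l * ?X p)"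
      by (simp add: d(1) distrib_left[of l] exp_add)
  qed
  also have "\<dots> = ?b * (1 + 2 * l * (\<Sum>j\<in>{k<..h}. avg (perms n)
      (\<lambda>p. of_bool (v \<subseteq> walk_vertex n p (n - j)) / real ((n - k) choose (j - k)))))"
    unfolding avg_cmult avg_add avg_sum avg_const[OF perms_nonempty] ..
  also have "(\<Sum>j\<in>{k<..h}. avg (perms n)
      (\<lambda>p. of_bool (v \<subseteq> walk_vertex n p (n - j)) / real ((n - k) choose (j - k))))
      = (\<Sum>j\<in>{k<..h}. 1 / real (n choose j))"
  proof (rule sum.cong)
    fix j assume j: "j \<in> {k<..h}"
    have "avg (perms n) (\<lambda>p. of_bool (v \<subseteq> walk_vertex n p (n - j)) / real ((n - k) choose (j - k)))
       = (1 / real ((n - k) choose (j - k))) * avg (perms n) (\<lambda>p. of_bool (v \<subseteq> walk_vertex n p (n - j)))"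
      unfolding avg_cmult[symmetric] by simp
    \<comment> \<open>The number of vertices above \<open>v\<close> on level j cancels against their
      common weight.\<close>
    also have "\<dots> = 1 / real (n choose j)"
      using j h by (subst prob_walk_above[OF v]) auto
    finally show "avg (perms n) (\<lambda>p. of_bool (v \<subseteq> walk_vertex n p (n - j)) / real ((n - k) choose (j - k)))
       = 1 / real (n choose j)" .
  qed simp
  finally show ?thesis by (simp add: mult.commute)
qed

lemma seq_avg_exp_blocking:
  assumes v: "v \<in> level n k" and h: "h < n" "k < n"
  defines "l \<equiv> real (n - k)"
  shows "seq_avg (perms n) t (\<lambda>ws. exp (l * blocking n h v ws))
    \<le> exp (2 * l * (\<Sum>j\<in>{k<..h}. 1 / real (n choose j)) * real t)"
proof -
  let ?s = "\<Sum>j\<in>{k<..h}. 1 / real (n choose j)"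
  have s0: "?s \<ge> 0" by (intro sum_nonneg) auto
  have l0: "l \<ge> 0" by (simp add: l_def)
  \<comment> \<open>Initially only \<open>{}\<close> is occupied, and it lies strictly above
    nothing.\<close>
  have b0: "blocking n h v [] = 0"
    by (auto simp: blocking_def cluster_above_def dla_cluster_def intro!: sum.neutral)
  have "seq_avg (perms n) (0 + t) (\<lambda>ws. exp (l * blocking n h v ws))
     \<le> (1 + 2 * l * ?s) ^ t * seq_avg (perms n) 0 (\<lambda>ws. exp (l * blocking n h v ws))"
    using avg_exp_blocking_step[OF v _ h] s0 l0
    by (intro seq_avg_contract perms_nonempty) (auto simp: l_def)
  also have "\<dots> = (1 + 2 * l * ?s) ^ t" using b0 by simp
  also have "\<dots> \<le> exp (2 * l * ?s) ^ t"
    using s0 l0 by (intro power_mono exp_ge_add_one_self) auto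
  also have "\<dots> = exp (2 * l * ?s * real t)"
    by (simp add: exp_of_nat_mult[symmetric] mult.commute)
  finally show ?thesis by simp
qed

section \<open>Occupying a vertex\<close>

text \<open>A walk through \<open>v\<close> next meets the full level k - 1, so it deposits
  \<open>v\<close> unless it met the cluster earlier. A union bound over the possible earlier
  meeting points gives the subtracted term. Emptiness of level \<open>h\<close> excludes termination
  and keeps these points below the cap.\<close>

lemma prob_occupy:
  assumes v: "v \<in> level n k" and ws: "set ws \<subseteq> perms n" and k: "0 < k"
    and below: "level n (k - 1) \<subseteq> dla_cluster n ws" and nv: "v \<notin> dla_cluster n ws"
    and low: "dla_cluster n ws \<inter> level n h = {}" and h: "h \<le> n"
  shows "(1 - blocking n h v ws) / real (n choose k)
    \<le> avg (perms n) (\<lambda>p. of_bool (v \<in> dla_cluster n (ws @ [p])))"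
proof -
  let ?A = "cluster_above n h v ws"
  have cv: "card v = k" "v \<subseteq> {0..<n}" using v by (auto simp: level_def)
  have kn: "k \<le> n" using card_mono[of "{0..<n}" v] cv by simp
  have small: "card x < h" if "x \<in> dla_cluster n ws" for x
    using dla_cluster_level_reached[OF ws that, of h] low by force
  have top: "{0..<n} \<notin> dla_cluster n ws" using small[of "{0..<n}"] h by auto
  have "(1 - blocking n h v ws) / real (n choose k) = 1 / real (n choose k) -
      (\<Sum>x\<in>?A. 1 / (real (n choose k) * real ((n - k) choose (card x - k))))"
    unfolding blocking_def cv by (simp add: diff_divide_distrib sum_divide_distrib mult.commute)
  also have "\<dots> = avg (perms n) (\<lambda>p. of_bool (walk_vertex n p (n - k) = v) -
      (\<Sum>x\<in>?A. of_bool (walk_vertex n p (n - k) = v \<and> walk_vertex n p (n - card x) = x)))"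
    unfolding avg_diff avg_sum prob_walk_through[OF v]
    by (intro arg_cong2[where f = "(-)"] refl sum.cong prob_walk_through2[OF v, symmetric])
       (use cluster_above_levels[OF v ws] in auto)
  also have "\<dots> \<le> avg (perms n) (\<lambda>p. of_bool (v \<in> dla_cluster n (ws @ [p])))"
  proof (rule avg_mono)
    fix p assume p: "p \<in> perms n"
    let ?s = "\<Sum>x\<in>?A. of_bool (walk_vertex n p (n - k) = v \<and> walk_vertex n p (n - card x) = x) :: real"
    have s0: "?s \<ge> 0" by (intro sum_nonneg) auto
    show "of_bool (walk_vertex n p (n - k) = v) - ?s \<le> of_bool (v \<in> dla_cluster n (ws @ [p]))"
    proof (cases "walk_vertex n p (n - k) = v \<and> v \<notin> dla_cluster n (ws @ [p])")
      case True
      hence pv: "walk_vertex n p (n - k) = v" by simp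
      have "walk_vertex n p (Suc (n - k)) \<in> level n (k - 1)"
        using card_walk_vertex[OF p, of "Suc (n - k)"] k kn by (auto simp: level_def walk_vertex_def)
      hence hit: "walk_vertex n p (Suc (n - k)) \<in> dla_cluster n ws" using below by auto
      \<comment> \<open>Since \<open>v\<close> is vacant after a walk that runs through it into the
        cluster, that walk must have met an occupied vertex no later than index
        \<open>n - k\<close>.\<close>
      have "\<not> (\<forall>j\<le>n - k. walk_vertex n p j \<notin> dla_cluster n ws)"
        using dla_step_occupies[OF top _ hit] True pv by (auto simp: dla_cluster_snoc)
      then obtain j where j: "j \<le> n - k" "walk_vertex n p j \<in> dla_cluster n ws" by auto
      let ?x = "walk_vertex n p j"
      have cx: "card ?x = n - j" using card_walk_vertex[OF p, of j] j by simp
      have "v \<subseteq> ?x" using walk_vertex_antimono[OF j(1), of n p] pv by simp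
      moreover have "v \<noteq> ?x" using j nv by auto
      ultimately have xA: "?x \<in> ?A" using j small[OF j(2)] by (auto simp: cluster_above_def)
      have "of_bool (walk_vertex n p (n - k) = v \<and> walk_vertex n p (n - card ?x) = ?x) \<le> ?s"
        by (rule member_le_sum[OF xA]) (auto intro: finite_cluster_above[OF ws])
      moreover have "n - card ?x = j" using cx j by simp
      ultimately have "?s \<ge> 1" using pv by simp
      moreover have "of_bool (walk_vertex n p (n - k) = v) \<le> (1::real)"
        "(0::real) \<le> of_bool (v \<in> dla_cluster n (ws @ [p]))" by simp_all
      ultimately show ?thesis by linarith
    next
      case False
      hence "of_bool (walk_vertex n p (n - k) = v) \<le> (of_bool (v \<in> dla_cluster n (ws @ [p])) :: real)"
        by simp
      with s0 show ?thesis by linarith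
    qed
  qed
  finally show ?thesis .
qed

lemma blocking_mono:
  assumes "set (ws @ us) \<subseteq> perms n"
  shows "blocking n h v ws \<le> blocking n h v (ws @ us)"
  unfolding blocking_def
  using dla_cluster_append_mono[of n ws us]
  by (intro sum_mono2 finite_cluster_above assms) (auto simp: cluster_above_def)

text \<open>While the event lasts, each walk after time \<open>a\<close> has chance at least 1 / (2
  (n choose k)) to occupy \<open>v\<close>. Placing the bounds on blocking and height inside the
  event avoids conditioning on them.\<close>

lemma seq_avg_unoccupied:
  assumes v: "v \<in> level n k" and k: "0 < k" and h: "h \<le> n"
  shows "seq_avg (perms n) (a + b) (\<lambda>ws. of_bool (level n (k - 1) \<subseteq> dla_cluster n (take a ws) \<and>
      v \<notin> dla_cluster n ws \<and> blocking n h v ws \<le> 1 / 2 \<and> dla_cluster n ws \<inter> level n h = {}))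
    \<le> exp (- real b / (2 * real (n choose k)))"
    (is "seq_avg _ _ (\<lambda>ws. of_bool (?P ws)) \<le> _")
proof -
  let ?q = "1 - 1 / (2 * real (n choose k))"
  have "k \<le> n" using v card_mono[of "{0..<n}" v] by (auto simp: level_def)
  hence c1: "real (n choose k) \<ge> 1" by (simp add: Suc_leI)
  have q0: "?q \<ge> 0" using c1 by (simp add: divide_le_eq)
  have step: "avg (perms n) (\<lambda>p. of_bool (?P (ws @ [p]))) \<le> ?q * of_bool (?P ws)"
    if ws: "set ws \<subseteq> perms n" "length ws \<ge> a" for ws
  proof -
    \<comment> \<open>The event can only be lost as time goes on: its first clause is fixed at time
      \<open>a\<close>, and the others pass to smaller clusters.\<close>
    have imp: "?P ws \<and> v \<notin> dla_cluster n (ws @ [p])" if "?P (ws @ [p])" "p \<in> perms n" for p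
    proof -
      have "set (ws @ [p]) \<subseteq> perms n" using that ws by simp
      from blocking_mono[OF this, of h v] that ws dla_cluster_append_mono[of n ws "[p]"]
      show ?thesis by auto
    qed
    show ?thesis
    proof (cases "?P ws")
      case False
      hence "avg (perms n) (\<lambda>p. of_bool (?P (ws @ [p]))) \<le> avg (perms n) (\<lambda>p. 0)"
        using imp by (intro avg_mono) auto
      also have "\<dots> = 0" by (rule avg_const[OF perms_nonempty])
      finally show ?thesis by (simp only: False of_bool_eq mult_zero_right)
    next
      case True
      have "avg (perms n) (\<lambda>p. of_bool (?P (ws @ [p])))
         \<le> avg (perms n) (\<lambda>p. 1 - of_bool (v \<in> dla_cluster n (ws @ [p])))"
        using imp by (intro avg_mono) auto
      also have "\<dots> = 1 - avg (perms n) (\<lambda>p. of_bool (v \<in> dla_cluster n (ws @ [p])))"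
        unfolding avg_diff avg_const[OF perms_nonempty] ..
      also have "\<dots> \<le> 1 - (1 - blocking n h v ws) / real (n choose k)"
      proof (intro diff_left_mono prob_occupy[OF v ws(1) k _ _ _ h])
        have "dla_cluster n (take a ws) \<subseteq> dla_cluster n (take a ws @ drop a ws)"
          by (rule dla_cluster_append_mono)
        thus "level n (k - 1) \<subseteq> dla_cluster n ws" using True by auto
      qed (use True in auto)
      also have "\<dots> \<le> ?q"
      proof -
        have "(1 / 2) / real (n choose k) \<le> (1 - blocking n h v ws) / real (n choose k)"
          using True by (intro divide_right_mono) auto
        thus ?thesis by simp
      qed
      finally show ?thesis by (simp only: True of_bool_eq mult_1_right simp_thms)
    qed
  qed
  have "seq_avg (perms n) (a + b) (\<lambda>ws. of_bool (?P ws)) \<le> ?q ^ b * seq_avg (perms n) a (\<lambda>ws. of_bool (?P ws))"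
    by (rule seq_avg_contract[OF perms_nonempty(1) q0 step])
  also have "\<dots> \<le> ?q ^ b * seq_avg (perms n) a (\<lambda>ws. 1)"
    using q0 by (intro mult_left_mono seq_avg_mono zero_le_power) auto
  also have "\<dots> = ?q ^ b" by (simp add: seq_avg_const[OF perms_nonempty])
  also have "\<dots> \<le> exp (- (1 / (2 * real (n choose k)))) ^ b"
    using exp_ge_add_one_self[of "- (1 / (2 * real (n choose k)))"] q0 by (intro power_mono) auto
  also have "\<dots> = exp (- real b / (2 * real (n choose k)))"
    by (simp add: exp_of_nat_mult[symmetric])
  finally show ?thesis .
qed

section \<open>Union bound\<close>

text \<open>The ratio of the two coefficients is (n - j) / (j + 1), which is at least 2 exactly
  under the hypothesis.\<close>

lemma binomial_doubling:
  assumes "3 * j + 2 \<le> n"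
  shows "2 * (n choose j) \<le> n choose Suc j"
proof -
  have "Suc j * (2 * (n choose j)) \<le> (n - j) * (n choose j)"
    using mult_le_mono1[of "2 * Suc j" "n - j" "n choose j"] assms by (simp add: algebra_simps)
  also have "\<dots> = Suc j * (n choose Suc j)"
    unfolding binomial_absorption binomial_absorb_comp ..
  finally show ?thesis by (simp only: mult_le_cancel1 zero_less_Suc simp_thms)
qed

lemma binomial_ge_pow2: "3 * (k + i) \<le> n \<Longrightarrow> 2 ^ i * (n choose k) \<le> n choose (k + i)"
proof (induction i)
  case (Suc i)
  thus ?case using binomial_doubling[of "k + i" n] by simp
qed simp

text \<open>Comparison with a geometric series; keeping the (1/2)^m term lets the induction
  close.\<close>

lemma sum_inverse_binomial:
  "3 * (k + m) \<le> n \<Longrightarrow>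
    (\<Sum>j\<in>{k<..k + m}. 1 / real (n choose j)) \<le> (2 - 2 * (1 / 2) ^ m) / real (n choose Suc k)"
proof (induction m)
  case (Suc m)
  have ins: "{k<..k + Suc m} = insert (Suc k + m) {k<..k + m}" by auto
  have "2 ^ m * (n choose Suc k) \<le> n choose (Suc k + m)"
    using Suc by (intro binomial_ge_pow2) simp
  hence "2 ^ m * real (n choose Suc k) \<le> real (n choose (Suc k + m))"
    by (simp flip: of_nat_le_iff[where 'a = real])
  moreover have "real (n choose Suc k) > 0" using Suc by simp
  ultimately have "1 / real (n choose (Suc k + m)) \<le> 1 / (2 ^ m * real (n choose Suc k))"
    by (intro frac_le) auto
  also have "\<dots> = (1 / 2) ^ m / real (n choose Suc k)"
    by (simp add: power_divide)
  finally have "(\<Sum>j\<in>{k<..k + Suc m}. 1 / real (n choose j))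
     \<le> (1 / 2) ^ m / real (n choose Suc k) + (2 - 2 * (1 / 2) ^ m) / real (n choose Suc k)"
    unfolding ins using Suc by simp
  also have "\<dots> = (2 - 2 * (1 / 2) ^ Suc m) / real (n choose Suc k)"
    by (simp add: add_divide_distrib[symmetric])
  finally show ?case .
qed simp

lemma dla_prob_eq_seq_avg:
  "dla_prob n P = seq_avg (perms n) (2 ^ n) (\<lambda>ws. of_bool (P ws))"
proof -
  have ws: "walk_seqs n = seqs (perms n) (2 ^ n)"
    by (auto simp: walk_seqs_def seqs_def permutations_of_set_def)
  have fin: "finite (walk_seqs n)" unfolding ws by (intro finite_seqs perms_nonempty)
  have "card (walk_seqs n) \<noteq> 0" unfolding ws by (simp add: card_seqs)
  hence ne: "walk_seqs n \<noteq> {}" by auto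
  have "dla_prob n P = card (walk_seqs n \<inter> {ws. P ws}) / card (walk_seqs n)"
    unfolding dla_prob_def by (rule measure_pmf_of_set[OF ne fin])
  also have "\<dots> = seq_avg (perms n) (2 ^ n) (\<lambda>ws. of_bool (P ws))"
    using fin unfolding seq_avg_def ws by (simp add: card_seqs of_bool_def sum.If_cases)
  finally show ?thesis .
qed

section \<open>Bad events and the induction over levels\<close>

text \<open>The residual bad event for \<open>v\<close>: it stays vacant although nothing hinders
  it. It is used with \<open>a = T (k - 1)\<close> and the walks up to time
  \<open>T k\<close>.\<close>

definition stuck :: "nat \<Rightarrow> nat \<Rightarrow> nat \<Rightarrow> nat \<Rightarrow> nat set \<Rightarrow> nat list list \<Rightarrow> bool" where
  "stuck n h a k v ws \<longleftrightarrow> level n (k - 1) \<subseteq> dla_cluster n (take a ws) \<and>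
     v \<notin> dla_cluster n ws \<and> blocking n h v ws \<le> 1 / 2 \<and> dla_cluster n ws \<inter> level n h = {}"

lemma dla_cluster_take_mono: "dla_cluster n (take a ws) \<subseteq> dla_cluster n ws"
  using dla_cluster_append_mono[of n "take a ws" "drop a ws"] by simp

text \<open>Deterministic part: with the bad events excluded, fullness passes from level k - 1 at
  time \<open>T (k - 1)\<close> to level k at time \<open>T k\<close>. Controlling the height at
  time \<open>T K\<close> covers all earlier times because clusters only grow.\<close>

lemma levels_occupied:
  assumes ws: "set ws \<subseteq> perms n" and T: "mono_on {..K} T"
    and low: "dla_cluster n (take (T K) ws) \<inter> level n h = {}"
    and free: "\<And>k v. 0 < k \<Longrightarrow> k \<le> K \<Longrightarrow> v \<in> level n k \<Longrightarrow> blocking n h v (take (T k) ws) \<le> 1 / 2"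
    and nstuck: "\<And>k v. 0 < k \<Longrightarrow> k \<le> K \<Longrightarrow> v \<in> level n k \<Longrightarrow> \<not> stuck n h (T (k - 1)) k v (take (T k) ws)"
    and k: "k \<le> K"
  shows "level n k \<subseteq> dla_cluster n (take (T k) ws)"
  using k
proof (induction k)
  case 0
  have "set (take (T 0) ws) \<subseteq> perms n" using ws set_take_subset[of "T 0" ws] by blast
  hence "{} \<in> dla_cluster n (take (T 0) ws)" by (rule dla_cluster_invariants)
  moreover have "x = {}" if "x \<in> level n 0" for x
    using that finite_subset[of x "{0..<n}"] by (auto simp: level_def)
  ultimately show ?case by blast
next
  case (Suc k)
  show ?case
  proof
    fix v assume v: "v \<in> level n (Suc k)"
    have le: "T k \<le> T (Suc k)" "T (Suc k) \<le> T K"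
      using T Suc.prems by (auto simp: mono_on_def)
    have "take (T (Suc k)) ws = take (T (Suc k)) (take (T K) ws)" using le by (simp add: min_absorb1)
    hence "dla_cluster n (take (T (Suc k)) ws) \<inter> level n h = {}"
      using low dla_cluster_take_mono[of n "T (Suc k)" "take (T K) ws"] by auto
    moreover have "take (T k) (take (T (Suc k)) ws) = take (T k) ws" using le by (simp add: min_absorb1)
    ultimately show "v \<in> dla_cluster n (take (T (Suc k)) ws)"
      using nstuck[of "Suc k" v] free[of "Suc k" v] v Suc unfolding stuck_def by auto
  qed
qed

text \<open>Markov's inequality in pointwise form. Every term is nonnegative and at least 1 on its
  bad event: \<open>occ\<close> is a cardinality, and the exponential term exceeds 1 once blocking
  exceeds 1/2. Hence failure forces the sum to be at least 1.\<close>

lemma failure_le: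
  assumes ws: "set ws \<subseteq> perms n" and T: "mono_on {..K} T"
  shows "of_bool (\<not> (\<forall>k\<le>K. level n k \<subseteq> dla_cluster n ws)) \<le>
    occ n h (take (T K) ws) + (\<Sum>k=1..K. \<Sum>v\<in>level n k.
      exp (- real (n - k) / 2) * exp (real (n - k) * blocking n h v (take (T k) ws)) +
      of_bool (stuck n h (T (k - 1)) k v (take (T k) ws)))"
  (is "_ \<le> _ + (\<Sum>k=1..K. \<Sum>v\<in>level n k. ?f k v + ?g k v)")
proof -
  have nn: "0 \<le> ?f k v + ?g k v" for k v by (intro add_nonneg_nonneg) auto
  have s0: "0 \<le> (\<Sum>k=1..K. \<Sum>v\<in>level n k. ?f k v + ?g k v)"
    by (intro sum_nonneg nn)
  have o0: "0 \<le> occ n h (take (T K) ws)" by (simp add: occ_def)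
  show ?thesis
  proof (cases "occ n h (take (T K) ws) + (\<Sum>k=1..K. \<Sum>v\<in>level n k. ?f k v + ?g k v) < 1")
    case True
    have "real (card (dla_cluster n (take (T K) ws) \<inter> level n h)) < 1"
      using True s0 unfolding occ_def by linarith
    hence low: "dla_cluster n (take (T K) ws) \<inter> level n h = {}"
      using finite_cluster_level[of n "take (T K) ws" h] by simp
    have term_lt: "?f k v + ?g k v < 1" if k: "0 < k" "k \<le> K" and v: "v \<in> level n k" for k v
    proof -
      have "?f k v + ?g k v \<le> (\<Sum>v\<in>level n k. ?f k v + ?g k v)"
        by (rule member_le_sum[OF v]) (use nn finite_level in auto)
      also have "\<dots> \<le> (\<Sum>k=1..K. \<Sum>v\<in>level n k. ?f k v + ?g k v)"
        by (rule member_le_sum[where f = "\<lambda>k. \<Sum>v\<in>level n k. ?f k v + ?g k v"])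
           (use k nn in \<open>auto intro: sum_nonneg\<close>)
      finally show ?thesis using True o0 by linarith
    qed
    have free: "blocking n h v (take (T k) ws) \<le> 1 / 2"
      if k: "0 < k" "k \<le> K" and v: "v \<in> level n k" for k v
    proof (rule ccontr)
      assume "\<not> ?thesis"
      hence "real (n - k) * (1 / 2) \<le> real (n - k) * blocking n h v (take (T k) ws)"
        by (intro mult_left_mono) auto
      hence "1 \<le> ?f k v" unfolding exp_add[symmetric] by simp
      moreover have "0 \<le> ?g k v" by simp
      ultimately show False using term_lt[OF that] by linarith
    qed
    have nstuck: "\<not> stuck n h (T (k - 1)) k v (take (T k) ws)"
      if k: "0 < k" "k \<le> K" and v: "v \<in> level n k" for k v
    proof
      assume "stuck n h (T (k - 1)) k v (take (T k) ws)"
      hence "?g k v = 1" by simp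
      moreover have "0 \<le> ?f k v" by simp
      ultimately show False using term_lt[OF that] by linarith
    qed
    have "\<forall>k\<le>K. level n k \<subseteq> dla_cluster n ws"
      using levels_occupied[OF ws T low free nstuck] dla_cluster_take_mono by blast
    hence "of_bool (\<not> (\<forall>k\<le>K. level n k \<subseteq> dla_cluster n ws)) = (0::real)" by simp
    with o0 s0 show ?thesis by linarith
  next
    case False
    have "of_bool (\<not> (\<forall>k\<le>K. level n k \<subseteq> dla_cluster n ws)) \<le> (1::real)" by simp
    with False show ?thesis by linarith
  qed
qed

text \<open>\<open>M\<close> is the mean number of walks through a vertex of level k by time M (n
  choose k); \<open>m\<close> counts the levels at which the height estimate gains a factor. The
  hypotheses keep the levels below n/3, the times within the 2^n walks, and blocking rare.\<close>

lemma dla_failure_bound: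
  fixes n K M m :: nat
  assumes h: "3 * (Suc K + m) \<le> n" and TK: "M * (n choose K) \<le> 2 ^ n"
    and MK: "16 * M * (K + 1) \<le> n - K"
  shows "1 - dla_prob n (\<lambda>ws. \<forall>k\<le>K. level n k \<subseteq> dla_cluster n ws) \<le>
    real K * real n ^ K * (exp (- real (n - K) / 4) + exp (- real M / 4)) +
    2 ^ n * (\<Prod>i=1..m. real M / 2 ^ i)"
proof -
  define T where "T = (\<lambda>k. M * (n choose k))"
  define H where "H = Suc K + m"
  \<comment> \<open>Doubling leaves at least half of the time \<open>T (Suc k)\<close> for filling
    level k + 1 after level k is full.\<close>
  have Tstep: "2 * T k \<le> T (Suc k)" if "k < K" for k
    using binomial_doubling[of k n] that h unfolding T_def by (simp add: mult.left_commute)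
  have "T j \<le> T k" if "j \<le> k" "k \<le> K" for j k
    using that
  proof (induction k rule: dec_induct)
    case (step i)
    thus ?case using Tstep[of i] by simp
  qed simp
  hence T: "mono_on {..K} T" by (auto simp: mono_on_def)
  have T2: "T k \<le> 2 ^ n" if "k \<le> K" for k
    using T TK that by (metis T_def atMost_iff le_trans mono_onD order_refl)
  have Hn: "H < n" using h by (simp add: H_def)
  have take_avg: "seq_avg (perms n) (2 ^ n) (\<lambda>ws. f (take (T k) ws)) = seq_avg (perms n) (T k) f"
    if "k \<le> K" for f k
    using seq_avg_take[OF perms_nonempty, of n "T k" "2 ^ n - T k" f] T2[OF that] by simp
  let ?E1 = "exp (- real (n - K) / 4)" and ?E2 = "exp (- real M / 4)"

  have occ: "seq_avg (perms n) (2 ^ n) (\<lambda>ws. occ n H (take (T K) ws)) \<le> 2 ^ n * (\<Prod>i=1..m. real M / 2 ^ i)"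
  proof -
    have "seq_avg (perms n) (2 ^ n) (\<lambda>ws. occ n H (take (T K) ws)) = seq_avg (perms n) (T K) (occ n H)"
      by (rule take_avg) simp
    also have "\<dots> \<le> real (T K) * (\<Prod>i=1..m. real (T K) / real (n choose (K + i)))"
      unfolding H_def by (rule seq_avg_occ) simp
    also have "\<dots> \<le> 2 ^ n * (\<Prod>i=1..m. real M / 2 ^ i)"
    proof (intro mult_mono prod_mono conjI)
      show "real (T K) \<le> 2 ^ n" using T2[of K] by (simp add: of_nat_le_numeral_power_cancel_iff)
      fix i assume "i \<in> {1..m}"
      hence "2 ^ i * (n choose K) \<le> n choose (K + i)"
        using h by (intro binomial_ge_pow2) simp
      hence "2 ^ i * real (n choose K) \<le> real (n choose (K + i))"
        by (simp flip: of_nat_le_iff[where 'a = real])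
      moreover have c: "real (n choose K) > 0" using h by simp
      ultimately have "real (T K) / real (n choose (K + i)) \<le> real (T K) / (2 ^ i * real (n choose K))"
        by (intro frac_le) auto
      also have "\<dots> = real M / 2 ^ i" using c by (simp add: T_def)
      finally show "real (T K) / real (n choose (K + i)) \<le> real M / 2 ^ i" .
    qed (auto intro: prod_nonneg)
    finally show ?thesis .
  qed

  have block: "seq_avg (perms n) (2 ^ n) (\<lambda>ws. exp (- real (n - k) / 2) *
      exp (real (n - k) * blocking n H v (take (T k) ws))) \<le> ?E1"
    if k: "0 < k" "k \<le> K" and v: "v \<in> level n k" for k v
  proof -
    let ?l = "real (n - k)" and ?s = "\<Sum>j\<in>{k<..H}. 1 / real (n choose j)"
    have kn: "k < n" using k h by simp
    have "?s \<le> (2 - 2 * (1 / 2) ^ (H - k)) / real (n choose Suc k)"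
      using sum_inverse_binomial[of k "H - k" n] k h by (simp add: H_def)
    also have "\<dots> \<le> 2 / real (n choose Suc k)" by (intro divide_right_mono) auto
    finally have s: "?s \<le> 2 / real (n choose Suc k)" .
    have "Suc k * (n choose Suc k) = (n - k) * (n choose k)"
      unfolding binomial_absorption binomial_absorb_comp ..
    hence abs: "real (Suc k) * real (n choose Suc k) = real (n - k) * real (n choose k)"
      by (metis of_nat_mult)
    \<comment> \<open>The sum is governed by its first term, and (n choose k) / (n choose (k + 1)) =
      (k + 1) / (n - k); the factor 16 in \<open>MK\<close> then gives 1/8.\<close>
    have "?s * real (T k) \<le> 2 / real (n choose Suc k) * real (T k)"
      by (intro mult_right_mono s) auto
    also have "\<dots> = 2 * real M * (real (n choose k) / real (n choose Suc k))"
      by (simp add: T_def)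
    also have "real (n choose k) / real (n choose Suc k) = real (Suc k) / real (n - k)"
    proof -
      have "n choose Suc k > 0" "n - k > 0" using kn by auto
      thus ?thesis using abs by (simp add: frac_eq_eq mult.commute del: of_nat_Suc)
    qed
    also have "2 * real M * (real (Suc k) / real (n - k)) \<le> 1 / 8"
    proof -
      have "16 * M * Suc k \<le> 16 * M * (K + 1)" using k by simp
      also have "\<dots> \<le> n - K" by (rule MK)
      also have "\<dots> \<le> n - k" using k by simp
      finally have "16 * real M * real (Suc k) \<le> real (n - k)"
        by (metis of_nat_le_iff of_nat_mult of_nat_numeral)
      thus ?thesis using kn by (simp add: divide_le_eq del: of_nat_Suc of_nat_diff)
    qed
    finally have sT: "?s * real (T k) \<le> 1 / 8" .
    have "seq_avg (perms n) (2 ^ n) (\<lambda>ws. exp (- ?l / 2) * exp (?l * blocking n H v (take (T k) ws)))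
       = seq_avg (perms n) (T k) (\<lambda>ws. exp (- ?l / 2) * exp (?l * blocking n H v ws))"
      by (rule take_avg[OF k(2), of "\<lambda>ws. exp (- ?l / 2) * exp (?l * blocking n H v ws)"])
    also have "\<dots> = exp (- ?l / 2) * seq_avg (perms n) (T k) (\<lambda>ws. exp (?l * blocking n H v ws))"
      by (rule seq_avg_cmult)
    also have "\<dots> \<le> exp (- ?l / 2) * exp (2 * ?l * ?s * real (T k))"
      by (intro mult_left_mono seq_avg_exp_blocking[OF v Hn kn]) auto
    also have "\<dots> = exp (- ?l / 2 + 2 * ?l * (?s * real (T k)))"
      by (simp only: exp_add mult.assoc)
    \<comment> \<open>Of the exponent l/2 supplied by the threshold 1/2, the moment bound consumes
      l/4.\<close>
    also have "\<dots> \<le> exp (- ?l / 2 + 2 * ?l * (1 / 8))"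
      by (intro iffD2[OF exp_le_cancel_iff] add_left_mono mult_left_mono sT) auto
    also have "\<dots> \<le> ?E1" using k by simp
    finally show ?thesis .
  qed

  have stuck: "seq_avg (perms n) (2 ^ n) (\<lambda>ws. of_bool (stuck n H (T (k - 1)) k v (take (T k) ws))) \<le> ?E2"
    if k: "0 < k" "k \<le> K" and v: "v \<in> level n k" for k v
  proof -
    have c: "real (n choose k) > 0" using k h by simp
    have le: "2 * T (k - 1) \<le> T k" using Tstep[of "k - 1"] k by simp
    have "seq_avg (perms n) (2 ^ n) (\<lambda>ws. of_bool (stuck n H (T (k - 1)) k v (take (T k) ws)))
       = seq_avg (perms n) (T (k - 1) + (T k - T (k - 1))) (\<lambda>ws. of_bool (stuck n H (T (k - 1)) k v ws))"
      using take_avg[OF k(2), of "\<lambda>ws. of_bool (stuck n H (T (k - 1)) k v ws)"] le by simp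
    also have "\<dots> \<le> exp (- real (T k - T (k - 1)) / (2 * real (n choose k)))"
      unfolding stuck_def by (rule seq_avg_unoccupied[OF v k(1)]) (use Hn in simp)
    also have "\<dots> \<le> ?E2"
    proof -
      \<comment> \<open>At least M (n choose k) / 2 walks remain, each with rate 1 / (2 (n choose
        k)): the exponent is M/4.\<close>
      have "T k \<le> 2 * (T k - T (k - 1))" using le by simp
      hence "real (T k) \<le> real (2 * (T k - T (k - 1)))" by (simp only: of_nat_le_iff)
      hence "real M * real (n choose k) \<le> 2 * real (T k - T (k - 1))"
        by (simp only: T_def of_nat_mult of_nat_numeral)
      hence "real M / 4 \<le> real (T k - T (k - 1)) / (2 * real (n choose k))"
        using c by (simp add: le_divide_eq)
      thus ?thesis by simp
    qed
    finally show ?thesis .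
  qed

  have "1 - dla_prob n (\<lambda>ws. \<forall>k\<le>K. level n k \<subseteq> dla_cluster n ws) =
     seq_avg (perms n) (2 ^ n) (\<lambda>ws. 1 - of_bool (\<forall>k\<le>K. level n k \<subseteq> dla_cluster n ws))"
    unfolding dla_prob_eq_seq_avg seq_avg_diff seq_avg_const[OF perms_nonempty] ..
  also have "\<dots> \<le> seq_avg (perms n) (2 ^ n) (\<lambda>ws. occ n H (take (T K) ws) + (\<Sum>k=1..K. \<Sum>v\<in>level n k.
      exp (- real (n - k) / 2) * exp (real (n - k) * blocking n H v (take (T k) ws)) +
      of_bool (stuck n H (T (k - 1)) k v (take (T k) ws))))"
  proof (rule seq_avg_mono)
    fix ws assume "ws \<in> seqs (perms n) (2 ^ n)"
    hence "set ws \<subseteq> perms n" by (simp add: seqs_def)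
    from failure_le[OF this T, of H]
    show "1 - of_bool (\<forall>k\<le>K. level n k \<subseteq> dla_cluster n ws) \<le>
      occ n H (take (T K) ws) + (\<Sum>k=1..K. \<Sum>v\<in>level n k.
      exp (- real (n - k) / 2) * exp (real (n - k) * blocking n H v (take (T k) ws)) +
      of_bool (stuck n H (T (k - 1)) k v (take (T k) ws)))"
      unfolding of_bool_not_iff .
  qed
  also have "\<dots> \<le> 2 ^ n * (\<Prod>i=1..m. real M / 2 ^ i) + (\<Sum>k=1..K. \<Sum>v\<in>level n k. ?E1 + ?E2)"
    unfolding seq_avg_add seq_avg_sum
    by (intro add_mono sum_mono occ block stuck) auto
  also have "(\<Sum>k=1..K. \<Sum>v\<in>level n k. ?E1 + ?E2) \<le> (\<Sum>k=1..K. real n ^ K * (?E1 + ?E2))"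
  proof (rule sum_mono)
    fix k assume k: "k \<in> {1..K}"
    have "n choose k \<le> n ^ k" using k h by (intro binomial_le_pow) simp
    also have "\<dots> \<le> n ^ K" using k h by (intro power_increasing) auto
    finally have "real (n choose k) \<le> real n ^ K" by (metis of_nat_le_iff of_nat_power)
    thus "(\<Sum>v\<in>level n k. ?E1 + ?E2) \<le> real n ^ K * (?E1 + ?E2)"
      by (simp add: card_level mult_right_mono)
  qed
  finally show ?thesis by (simp add: mult.assoc)
qed

section \<open>Asymptotics\<close>

text \<open>The exponent is 1 + ... + m; with \<open>powr\<close> it can later be compared with a
  real expression in n/8.\<close>

lemma prod_div_pow2:
  fixes x :: real
  shows "(\<Prod>i=1..m. x / 2 ^ i) = x ^ m * 2 powr (- (real m * (real m + 1) / 2))"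
proof (induction m)
  case (Suc m)
  have "- (real (Suc m) * (real (Suc m) + 1) / 2) = - (real m * (real m + 1) / 2) - real (Suc m)"
    by (simp add: field_simps)
  hence "2 powr (- (real (Suc m) * (real (Suc m) + 1) / 2))
      = 2 powr (- (real m * (real m + 1) / 2) - real (Suc m))"
    by (rule arg_cong)
  also have "\<dots> = 2 powr (- (real m * (real m + 1) / 2)) / 2 ^ Suc m"
    unfolding powr_diff by (simp only: powr_realpow zero_less_numeral)
  finally have eq: "2 powr (- (real (Suc m) * (real (Suc m) + 1) / 2))
      = 2 powr (- (real m * (real m + 1) / 2)) / 2 ^ Suc m" .
  have "(\<Prod>i=1..Suc m. x / 2 ^ i) = (\<Prod>i=1..m. x / 2 ^ i) * (x / 2 ^ Suc m)" by simp
  thus ?case unfolding eq Suc by simp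
qed simp

text \<open>Absorbs floors and ceilings, so that hypotheses and bound become explicit real functions
  of n and r, open to asymptotic comparison. \<open>a\<close> is an upper bound for the integer
  \<open>M\<close>.\<close>

lemma dla_failure_bound_explicit:
  fixes n :: nat and r :: real
  defines "a \<equiv> 8 * (r + 1) * ln (real n) + 1"
  assumes n: "n \<ge> 2" and r: "r \<ge> 0"
    and h: "3 * (1 + r + real n / 8) \<le> real n"
    and M2: "a \<le> 2 powr (real n / 8 - 1)"
    and MK: "16 * a * (r + 1) + r \<le> real n"
  shows "1 - dla_prob n (\<lambda>ws. \<forall>k::nat. real k \<le> r \<longrightarrow> level n k \<subseteq> dla_cluster n ws) \<le>
    r * exp (r * ln (real n) - (real n - r) / 4) + r * exp (- 2 * ln (real n)) +
    2 powr real n * (real n powr (real n / 8) * 2 powr (- ((real n / 8 - 1) * (real n / 8) / 2)))"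
proof -
  define K where "K = nat \<lfloor>r\<rfloor>"
  \<comment> \<open>The factor 8 makes M/4 at least 2 (K + 1) log n, which beats the n^K vertices of
    a level and leaves n^(-2).\<close>
  define M where "M = nat \<lceil>8 * (real K + 1) * ln (real n)\<rceil>"
  \<comment> \<open>Linearly many levels make the product of ratios decay like 2 to the power of a
    negative multiple of n^2, while K + 1 + m stays below n/3.\<close>
  define m where "m = n div 8"
  have ln0: "ln (real n) \<ge> 0" using n by simp
  have Kr: "k \<le> K \<longleftrightarrow> real k \<le> r" for k
    using r unfolding K_def by (simp add: le_nat_iff le_floor_iff)
  have K: "real K \<le> r" using Kr by blast
  have Mlow: "8 * (real K + 1) * ln (real n) \<le> real M"
    unfolding M_def by (rule real_nat_ceiling_ge)
  have "0 \<le> 8 * (real K + 1) * ln (real n)" using ln0 by simp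
  hence "real M \<le> 8 * (real K + 1) * ln (real n) + 1" unfolding M_def by linarith
  also have "\<dots> \<le> a" unfolding a_def using K ln0 by (intro add_mono mult_right_mono) auto
  finally have Ma: "real M \<le> a" .
  have m: "real m \<le> real n / 8" "real n / 8 - 1 \<le> real m" unfolding m_def by linarith+
  have a0: "a \<ge> 1" using r ln0 by (simp add: a_def)
  have an: "a \<le> real n"
  proof -
    have "a * 1 \<le> 16 * a * (r + 1)" using a0 r by (simp add: algebra_simps)
    thus ?thesis using MK r by linarith
  qed

  have "real (3 * (Suc K + m)) \<le> real n" using h K m by simp
  hence C1: "3 * (Suc K + m) \<le> n" by linarith
  \<comment> \<open>Climbing \<open>m\<close> levels multiplies the binomial coefficient by at least
    2^m, so \<open>M\<close> times (n choose K) stays below a single coefficient.\<close>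
  have "real M \<le> 2 powr real m"
    using Ma M2 m(2) by (smt (verit) powr_mono)
  hence "M \<le> 2 ^ m" by (simp add: powr_realpow)
  hence "M * (n choose K) \<le> 2 ^ m * (n choose K)" by simp
  also have "\<dots> \<le> n choose (K + m)" using C1 by (intro binomial_ge_pow2) simp
  also have "\<dots> \<le> 2 ^ n" by (rule binomial_le_pow2)
  finally have C2: "M * (n choose K) \<le> 2 ^ n" .
  have "16 * real M * (real K + 1) + real K \<le> 16 * a * (r + 1) + r"
    using Ma K a0 by (intro add_mono mult_mono) auto
  also have "\<dots> \<le> real n" by (rule MK)
  finally have "real (16 * M * (K + 1) + K) \<le> real n" by (simp add: algebra_simps)
  hence C3: "16 * M * (K + 1) \<le> n - K" by linarith
  have Kn: "K \<le> n" using C1 by simp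

  have powK: "real n ^ K = exp (real K * ln (real n))"
    using n by (simp add: exp_of_nat_mult)
  have "1 - dla_prob n (\<lambda>ws. \<forall>k\<le>K. level n k \<subseteq> dla_cluster n ws) \<le>
      real K * real n ^ K * (exp (- real (n - K) / 4) + exp (- real M / 4)) +
      2 ^ n * (\<Prod>i=1..m. real M / 2 ^ i)"
    by (rule dla_failure_bound[OF C1 C2 C3])
  also have "real K * real n ^ K * (exp (- real (n - K) / 4) + exp (- real M / 4))
     = real K * exp (real K * ln (real n) - (real n - real K) / 4)
       + real K * exp (real K * ln (real n) - real M / 4)"
    unfolding powK of_nat_diff[OF Kn]
    by (simp only: distrib_left mult.assoc exp_add[symmetric] diff_conv_add_uminus minus_divide_left)
  also have "real K * exp (real K * ln (real n) - (real n - real K) / 4)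
     \<le> r * exp (r * ln (real n) - (real n - r) / 4)"
    using K r ln0
    by (intro mult_mono iffD2[OF exp_le_cancel_iff] diff_mono divide_right_mono mult_right_mono) auto
  also have "real K * exp (real K * ln (real n) - real M / 4) \<le> r * exp (- 2 * ln (real n))"
  proof (intro mult_mono iffD2[OF exp_le_cancel_iff])
    have "0 \<le> real K * ln (real n)" using ln0 by simp
    thus "real K * ln (real n) - real M / 4 \<le> - 2 * ln (real n)"
      using Mlow by (simp add: algebra_simps)
  qed (use K r in auto)
  also have "2 ^ n * (\<Prod>i=1..m. real M / 2 ^ i) \<le>
    2 powr real n * (real n powr (real n / 8) * 2 powr (- ((real n / 8 - 1) * (real n / 8) / 2)))"
  proof (rule mult_mono)
    \<comment> \<open>The crude replacement of \<open>M\<close> by n is affordable because the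
      exponent of 2 is quadratic in n.\<close>
    have "(\<Prod>i=1..m. real M / 2 ^ i) \<le> (\<Prod>i=1..m. real n / 2 ^ i)"
      using Ma an by (intro prod_mono conjI divide_right_mono) auto
    also have "\<dots> = real n powr real m * 2 powr (- (real m * (real m + 1) / 2))"
      using n unfolding prod_div_pow2 by (simp add: powr_realpow)
    also have "\<dots> \<le> real n powr (real n / 8) * 2 powr (- ((real n / 8 - 1) * (real n / 8) / 2))"
    proof (intro mult_mono powr_mono)
      have "(real n / 8 - 1) * (real n / 8) \<le> real m * (real m + 1)"
      proof (rule mult_mono)
        show "real n / 8 \<le> real m + 1" using m by simp
      qed (use m in auto)
      thus "- (real m * (real m + 1) / 2) \<le> - ((real n / 8 - 1) * (real n / 8) / 2)"
        unfolding neg_le_iff_le by (rule divide_right_mono) simp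
    qed (use m n in auto)
    finally show "(\<Prod>i=1..m. real M / 2 ^ i) \<le>
       real n powr (real n / 8) * 2 powr (- ((real n / 8 - 1) * (real n / 8) / 2))" .
  qed (auto simp: powr_realpow intro: prod_nonneg)
  finally show ?thesis unfolding Kr by simp
qed

theorem theorem1:
  shows "\<exists>c0::real. c0 > 0 \<and>
    (\<lambda>n. dla_prob n (\<lambda>ws. \<forall>k::nat. real k \<le> sqrt (c0 * real n / ln (real n)) \<longrightarrow>
                              level n k \<subseteq> dla_cluster n ws))
    \<longlonglongrightarrow> 1"
proof (intro exI[of _ "1/1000 :: real"] conjI)
  define r :: "nat \<Rightarrow> real" where "r n = sqrt (1/1000 * real n / ln (real n))" for n
  define P where "P n = dla_prob n (\<lambda>ws. \<forall>k::nat. real k \<le> r n \<longrightarrow> level n k \<subseteq> dla_cluster n ws)" for n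
  define e where "e n = r n * exp (r n * ln (real n) - (real n - r n) / 4) + r n * exp (- 2 * ln (real n)) +
    2 powr real n * (real n powr (real n / 8) * 2 powr (- ((real n / 8 - 1) * (real n / 8) / 2)))" for n
  \<comment> \<open>Here r log n has order sqrt (n log n), negligible against n/4; the second term
    is r / n^2; in the third, an exponent of order -n^2 dominates n and n log n.\<close>
  have e: "e \<longlonglongrightarrow> 0" unfolding e_def r_def
    by (intro tendsto_add_zero) real_asymp+
  have ev1: "\<forall>\<^sub>F n in sequentially. 3 * (1 + r n + real n / 8) \<le> real n"
    unfolding r_def by real_asymp
  have ev2: "\<forall>\<^sub>F n in sequentially. 8 * (r n + 1) * ln (real n) + 1 \<le> 2 powr (real n / 8 - 1)"
    unfolding r_def by real_asymp
  have ev3: "\<forall>\<^sub>F n in sequentially. 256 * (r n * ln (real n)) + 128 * ln (real n) + 17 * r n + 16 \<le> real n / 2"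
    unfolding r_def by real_asymp
  have lower: "\<forall>\<^sub>F n in sequentially. 1 - e n \<le> P n"
    using ev1 ev2 ev3 eventually_ge_at_top[of 2]
  proof eventually_elim
    case (elim n)
    have r0: "r n \<ge> 0" using elim by (simp add: r_def)
    have "ln (real n) > 0" using elim by simp
    hence "(r n)\<^sup>2 * ln (real n) = real n / 1000" by (simp add: r_def)
    \<comment> \<open>This fixes the constant 1/1000: the leading term 128 r^2 log n becomes 128 n /
      1000, and together with the n/2 reserved for the lower-order terms it stays below n.\<close>
    hence "16 * (8 * (r n + 1) * ln (real n) + 1) * (r n + 1) + r n =
      128 / 1000 * real n + (256 * (r n * ln (real n)) + 128 * ln (real n) + 17 * r n + 16)"
      by (simp add: power2_eq_square algebra_simps)
    also have "\<dots> \<le> real n" using elim by linarith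
    finally have "1 - P n \<le> e n"
      unfolding P_def e_def by (intro dla_failure_bound_explicit r0 elim)
    thus ?case by simp
  qed
  have upper: "\<forall>\<^sub>F n in sequentially. P n \<le> 1"
    unfolding P_def dla_prob_def by (simp add: measure_pmf.prob_le_1)
  have "P \<longlonglongrightarrow> 1"
    by (rule tendsto_sandwich[OF lower upper]) (use tendsto_diff[OF tendsto_const e, of 1] in auto)
  thus "(\<lambda>n. dla_prob n (\<lambda>ws. \<forall>k::nat. real k \<le> sqrt (1/1000 * real n / ln (real n)) \<longrightarrow>
      level n k \<subseteq> dla_cluster n ws)) \<longlonglongrightarrow> 1"
    unfolding P_def r_def .
qed simp

end
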